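(* Let $\Omega\subset\mathbb{R}^N$ and let $K,K^\dagger,\eta,\kappa$ be as in the context. Consider the wave-like system $$\partial_t\alpha_1=\kappa\,\alpha_2,\qquad \partial_t\alpha_2=-K^\dagger(\eta K\alpha_1),$$ with $\alpha_1,\alpha_2$ taking values in $\mathbb{R}^n$. Define its Stokes-Dirac representation by $$\alpha^{SD}=\begin{bmatrix}\alpha^{SD}_1\\ \alpha^{SD}_2\end{bmatrix}:=\begin{bmatrix}K\alpha_1\\ \alpha_2\end{bmatrix},\quad e^{SD}:=\begin{bmatrix}\eta\,\alpha_1^{SD}\\ \kappa\,\alpha_2^{SD}\end{bmatrix},\quad J^{SD}:=\begin{bmatrix}0&K\\-K^\dagger&0\end{bmatrix},\quad \partial_t\alpha^{SD}=J^{SD}e^{SD},$$ and its Stokes-Lagrange representation by $$\alpha^{SL}=\begin{bmatrix}\alpha^{SL}_1\\ \alpha^{SL}_2\end{bmatrix}:=\begin{bmatrix}\alpha_1\\ \alpha_2\end{bmatrix},\quad e^{SL}:=\begin{bmatrix}K^\dagger(\eta K\alpha_1^{SL})\\ \kappa\,\alpha_2^{SL}\end{bmatrix},\quad J^{SL}:=\begin{bmatrix}0&\mathrm{Id}\\-\mathrm{Id}&0\end{bmatrix},\quad \partial_t\alpha^{SL}=J^{SL}e^{SL}.$$ Let $$G:=\begin{bmatrix}K&0\\0&\mathrm{Id}\end{bmatrix},\qquad G^\dagger:=\begin{bmatrix}K^\dagger&0\\0&\mathrm{Id}\end{bmatrix}.$$ Then $$\alpha^{SD}=G\,\alpha^{SL},\qquad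 G^\dagger e^{SD}=e^{SL},\qquad G\,J^{SL}\,G^\dagger=J^{SD}.$$
   Context: $K:\mathcal{D}(K)\subset L^2(\Omega,\mathbb{R}^n)\to L^2(\Omega,\mathbb{R}^m)$ is a closed, densely defined linear operator. $K^\dagger:\mathcal{D}(K^\dagger)\subset L^2(\Omega,\mathbb{R}^m)\to L^2(\Omega,\mathbb{R}^n)$ is its formal adjoint, i.e. its adjoint up to boundary terms. More precisely, there are a control space $\mathcal{U}$, an observation space $\mathcal{Y}=\mathcal{U}'$ and boundary operators $\gamma:\mathcal{D}(K)\to\mathcal{Y}$, $\beta:\mathcal{D}(K^\dagger)\to\mathcal{U}$ such that for all $\phi\in\mathcal{D}(K)$, $\psi\in\mathcal{D}(K^\dagger)$ $$\int_\Omega K(\phi)\cdot\psi\,dx=\int_\Omega\phi\cdot K^\dagger(\psi)\,dx+\langle\beta(\psi),\gamma(\phi)\rangle_{\mathcal{U},\mathcal{Y}},$$ and $(K|_{\ker\gamma})^*=K^\dagger$, $(K^\dagger|_{\ker\beta})^*=K$. The operators $\eta$ (acting on $L^2(\Omega,\mathbb{R}^m)$) and $\kappa$ (acting on $L^2(\Omega,\mathbb{R}^n)$) are bounded from above. The associated Hamiltonian is $H=\frac12\int_\Omega (K\alpha_1)\cdot\eta(K\alpha_1)+\alpha_2\cdot\kappa\,\alpha_2\,dx\ge 0$. All compositions of operators are understood on their natural domains, and states are such that the displayed expressions are defined (in particular $\alpha_1\in\mathcal{D}(K)$ and $\eta K\alpha_1\in\mathcal{D}(K^\dagger)$). *)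

theory Defs
  imports "HOL-Analysis.Analysis"
begin

section \<open>Square-integrable functions modulo almost-everywhere equality\<close>

definition square_integrable :: "('a::euclidean_space \<Rightarrow> 'b::euclidean_space) \<Rightarrow> bool" where
  "square_integrable f \<longleftrightarrow>
     f \<in> borel_measurable lebesgue \<and> integrable lebesgue (\<lambda>x. (norm (f x))\<^sup>2)"

definition L2_rel ::
  "('a::euclidean_space \<Rightarrow> 'b::euclidean_space) \<Rightarrow> ('a \<Rightarrow> 'b) \<Rightarrow> bool" where
  "L2_rel f g \<longleftrightarrow>
     square_integrable f \<and> square_integrable g \<and> (AE x in lebesgue. f x = g x)"

lemma square_integrable_zero: "square_integrable (\<lambda>_. 0)"
  by (simp add: square_integrable_def)

lemma square_integrable_scaleR:
  assumes "square_integrable f"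
  shows "square_integrable (\<lambda>x. c *\<^sub>R f x)"
proof -
  have m: "f \<in> borel_measurable lebesgue" and i: "integrable lebesgue (\<lambda>x. (norm (f x))\<^sup>2)"
    using assms by (simp_all add: square_integrable_def)
  have "(\<lambda>x. c *\<^sub>R f x) \<in> borel_measurable lebesgue"
    using m by (rule borel_measurable_scaleR[OF borel_measurable_const])
  moreover have "integrable lebesgue (\<lambda>x. \<bar>c\<bar>\<^sup>2 * (norm (f x))\<^sup>2)"
    using i by (rule integrable_mult_right)
  ultimately show ?thesis
    by (simp add: square_integrable_def power_mult_distrib)
qed

lemma square_integrable_add:
  assumes "square_integrable f" "square_integrable g"
  shows "square_integrable (\<lambda>x. f x + g x)"
proof -
  have m: "f \<in> borel_measurable lebesgue" "g \<in> borel_measurable lebesgue"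
    and i: "integrable lebesgue (\<lambda>x. (norm (f x))\<^sup>2)"
           "integrable lebesgue (\<lambda>x. (norm (g x))\<^sup>2)"
    using assms by (simp_all add: square_integrable_def)
  have le: "(norm (f x + g x))\<^sup>2 \<le> 2 * (norm (f x))\<^sup>2 + 2 * (norm (g x))\<^sup>2" for x
  proof -
    have "(norm (f x + g x))\<^sup>2 \<le> (norm (f x) + norm (g x))\<^sup>2"
      by (intro power_mono norm_triangle_ineq norm_ge_zero)
    also have "\<dots> \<le> 2 * (norm (f x))\<^sup>2 + 2 * (norm (g x))\<^sup>2"
      using sum_squares_bound[of "norm (f x)" "norm (g x)"] by (simp add: power2_sum)
    finally show ?thesis .
  qed
  have meas: "(\<lambda>x. f x + g x) \<in> borel_measurable lebesgue"
    using m by (rule borel_measurable_add)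
  have meas2: "(\<lambda>x. (norm (f x + g x))\<^sup>2) \<in> borel_measurable lebesgue"
    using meas by measurable
  have "integrable lebesgue (\<lambda>x. 2 * (norm (f x))\<^sup>2 + 2 * (norm (g x))\<^sup>2)"
    by (intro Bochner_Integration.integrable_add integrable_mult_right i)
  then have "integrable lebesgue (\<lambda>x. (norm (f x + g x))\<^sup>2)"
    by (rule Bochner_Integration.integrable_bound[OF _ meas2 AE_I2]) (use le in simp)
  then show ?thesis using meas by (simp add: square_integrable_def)
qed

lemma square_integrable_inner:
  assumes "square_integrable f" "square_integrable g"
  shows "integrable lebesgue (\<lambda>x. f x \<bullet> g x)"
proof -
  have m: "f \<in> borel_measurable lebesgue" "g \<in> borel_measurable lebesgue"
    and i: "integrable lebesgue (\<lambda>x. (norm (f x))\<^sup>2)"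
           "integrable lebesgue (\<lambda>x. (norm (g x))\<^sup>2)"
    using assms by (simp_all add: square_integrable_def)
  have "\<bar>f x \<bullet> g x\<bar> \<le> (norm (f x))\<^sup>2 + (norm (g x))\<^sup>2" for x
    using Cauchy_Schwarz_ineq2[of "f x" "g x"] sum_squares_bound[of "norm (f x)" "norm (g x)"]
      zero_le_mult_iff[of "norm (f x)" "norm (g x)"] norm_ge_zero[of "f x"] norm_ge_zero[of "g x"]
    by linarith
  then have le: "AE x in lebesgue. norm (f x \<bullet> g x) \<le> norm ((norm (f x))\<^sup>2 + (norm (g x))\<^sup>2)"
    by (intro AE_I2) simp
  have meas: "(\<lambda>x. f x \<bullet> g x) \<in> borel_measurable lebesgue"
    using m by (rule borel_measurable_inner)
  show ?thesis
    by (rule Bochner_Integration.integrable_bound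
          [OF Bochner_Integration.integrable_add[OF i] meas le])
qed

quotient_type (overloaded) ('a, 'b) L2 =
    "'a::euclidean_space \<Rightarrow> 'b::euclidean_space" / partial: L2_rel
  morphisms rep_L2 abs_L2
proof (rule part_equivpI)
  show "\<exists>f::'a \<Rightarrow> 'b. L2_rel f f"
    by (rule exI[of _ "\<lambda>_. 0"]) (simp add: L2_rel_def square_integrable_zero)
  show "symp (L2_rel :: ('a \<Rightarrow> 'b) \<Rightarrow> _)"
    by (auto simp: symp_def L2_rel_def elim: eventually_mono)
  show "transp (L2_rel :: ('a \<Rightarrow> 'b) \<Rightarrow> _)"
    by (auto simp: transp_def L2_rel_def elim: eventually_elim2)
qed

instantiation L2 :: (euclidean_space, euclidean_space) real_inner
begin

lift_definition zero_L2 :: "('a, 'b) L2" is "\<lambda>_. 0"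
  by (simp add: L2_rel_def square_integrable_zero)

lift_definition plus_L2 :: "('a, 'b) L2 \<Rightarrow> ('a, 'b) L2 \<Rightarrow> ('a, 'b) L2"
  is "\<lambda>f g x. f x + g x"
  by (auto simp: L2_rel_def square_integrable_add elim: eventually_elim2)

lift_definition scaleR_L2 :: "real \<Rightarrow> ('a, 'b) L2 \<Rightarrow> ('a, 'b) L2"
  is "\<lambda>c f x. c *\<^sub>R f x"
  by (auto simp: L2_rel_def square_integrable_scaleR elim: eventually_mono)

lift_definition inner_L2 :: "('a, 'b) L2 \<Rightarrow> ('a, 'b) L2 \<Rightarrow> real"
  is "\<lambda>f g. LINT x|lebesgue. f x \<bullet> g x"
  by (rule integral_cong_AE)
     (auto simp: L2_rel_def square_integrable_def elim: eventually_elim2)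

definition "uminus f = (-1) *\<^sub>R f" for f :: "('a, 'b) L2"
definition "f - g = f + (- g)" for f g :: "('a, 'b) L2"
definition "norm f = sqrt (f \<bullet> f)" for f :: "('a, 'b) L2"
definition "sgn f = inverse (norm f) *\<^sub>R f" for f :: "('a, 'b) L2"
definition "dist f g = norm (f - g)" for f g :: "('a, 'b) L2"
definition "uniformity = (INF e\<in>{0<..}. principal {(x::('a, 'b) L2, y). dist x y < e})"
definition "open U \<longleftrightarrow> (\<forall>x\<in>U. eventually (\<lambda>(x', y). x' = x \<longrightarrow> y \<in> U) uniformity)"
  for U :: "('a, 'b) L2 set"

instance
proof
  fix f g h :: "('a, 'b) L2" and a b :: real and U :: "('a, 'b) L2 set"
  show "f + g + h = f + (g + h)"
    by transfer (auto simp: L2_rel_def square_integrable_add add.assoc)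
  show "f + g = g + f"
    by transfer (auto simp: L2_rel_def square_integrable_add add.commute)
  show "0 + f = f"
    by transfer (auto simp: L2_rel_def square_integrable_add)
  show "- f + f = 0"
    unfolding uminus_L2_def
    by transfer (use square_integrable_zero in
      \<open>auto simp: L2_rel_def intro!: square_integrable_add square_integrable_scaleR\<close>)
  show "f - g = f + - g" by (rule minus_L2_def)
  show "a *\<^sub>R (f + g) = a *\<^sub>R f + a *\<^sub>R g"
    by transfer (auto simp: L2_rel_def square_integrable_add square_integrable_scaleR
      scaleR_add_right)
  show "(a + b) *\<^sub>R f = a *\<^sub>R f + b *\<^sub>R f"
    by transfer (auto simp: L2_rel_def square_integrable_add square_integrable_scaleR
      scaleR_add_left)
  show "a *\<^sub>R b *\<^sub>R f = (a * b) *\<^sub>R f"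
    by transfer (auto simp: L2_rel_def square_integrable_scaleR)
  show "1 *\<^sub>R f = f"
    by transfer (auto simp: L2_rel_def)
  show "dist f g = norm (f - g)" by (rule dist_L2_def)
  show "sgn f = inverse (norm f) *\<^sub>R f" by (rule sgn_L2_def)
  show "norm f = sqrt (f \<bullet> f)" by (rule norm_L2_def)
  show "uniformity = (INF e\<in>{0<..}. principal {(x::('a, 'b) L2, y). dist x y < e})"
    by (rule uniformity_L2_def)
  show "open U \<longleftrightarrow> (\<forall>x\<in>U. eventually (\<lambda>(x', y). x' = x \<longrightarrow> y \<in> U) uniformity)"
    by (rule open_L2_def)
  show "f \<bullet> g = g \<bullet> f"
    by transfer (simp add: inner_commute)
  show "(f + g) \<bullet> h = f \<bullet> h + g \<bullet> h"
    by transfer (auto simp: L2_rel_def inner_add_left square_integrable_inner)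
  show "(a *\<^sub>R f) \<bullet> g = a * (f \<bullet> g)"
    by transfer simp
  show "0 \<le> f \<bullet> f"
    by transfer simp
  show "f \<bullet> f = 0 \<longleftrightarrow> f = 0"
  proof transfer
    fix f :: "'a \<Rightarrow> 'b"
    assume "L2_rel f f"
    then have f: "square_integrable f" by (simp add: L2_rel_def)
    have "(LINT x|lebesgue. f x \<bullet> f x) = 0 \<longleftrightarrow> (AE x in lebesgue. f x \<bullet> f x = 0)"
      by (rule integral_nonneg_eq_0_iff_AE[OF square_integrable_inner[OF f f]]) simp
    then show "((LINT x|lebesgue. f x \<bullet> f x) = 0) = L2_rel f (\<lambda>_. 0)"
      using f by (simp add: L2_rel_def square_integrable_zero)
  qed
qed

end

text \<open>
  Since \<open>\<Omega>\<close> is a term, \<open>L\<^sup>2(\<Omega>)\<close> cannot be a type. For measurable \<open>\<Omega>\<close>, extension by zero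
  identifies it isometrically with the closed subspace of those classes in \<open>L\<^sup>2\<close> of the whole
  space that vanish almost everywhere outside \<open>\<Omega>\<close>; the inner product of two members of this
  subspace is the integral over \<open>\<Omega>\<close> (lemma \<open>inner_L2_on\<close>).
\<close>

lift_definition vanishes_off :: "'a::euclidean_space set \<Rightarrow> ('a, 'b::euclidean_space) L2 \<Rightarrow> bool"
  is "\<lambda>\<Omega> f. AE x in lebesgue. x \<notin> \<Omega> \<longrightarrow> f x = 0"
proof -
  fix \<Omega> :: "'a set" and f g :: "'a \<Rightarrow> 'b"
  assume "L2_rel f g"
  then have "AE x in lebesgue. f x = g x" by (simp add: L2_rel_def)
  then have "AE x in lebesgue. (x \<notin> \<Omega> \<longrightarrow> f x = 0) \<longleftrightarrow> (x \<notin> \<Omega> \<longrightarrow> g x = 0)"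
    by (rule eventually_mono) simp
  then show "(AE x in lebesgue. x \<notin> \<Omega> \<longrightarrow> f x = 0) \<longleftrightarrow> (AE x in lebesgue. x \<notin> \<Omega> \<longrightarrow> g x = 0)"
    by (rule eventually_subst)
qed

definition L2_on :: "'a::euclidean_space set \<Rightarrow> ('a, 'b::euclidean_space) L2 set" where
  "L2_on \<Omega> = {f. vanishes_off \<Omega> f}"

lemma vanishes_off_add:
  "vanishes_off \<Omega> f \<Longrightarrow> vanishes_off \<Omega> g \<Longrightarrow> vanishes_off \<Omega> (f + g)"
  by transfer (erule (1) eventually_elim2, simp)

lemma vanishes_off_scaleR: "vanishes_off \<Omega> f \<Longrightarrow> vanishes_off \<Omega> (c *\<^sub>R f)"
  by transfer (erule eventually_mono, simp)

lemma subspace_L2_on: "subspace (L2_on \<Omega>)"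
proof -
  have "vanishes_off \<Omega> 0" by transfer simp
  then show ?thesis
    by (simp add: subspace_def L2_on_def vanishes_off_add vanishes_off_scaleR)
qed

lemma inner_L2_on:
  assumes "square_integrable f" "square_integrable g"
    and "\<Omega> \<in> sets lebesgue" "abs_L2 f \<in> L2_on \<Omega>"
  shows "abs_L2 f \<bullet> abs_L2 g = (LINT x:\<Omega>|lebesgue. f x \<bullet> g x)"
proof -
  have r: "L2_rel f f" "L2_rel g g"
    using assms by (auto simp: L2_rel_def)
  have v: "AE x in lebesgue. x \<notin> \<Omega> \<longrightarrow> f x = 0"
    using assms(4) r(1) by (simp add: L2_on_def vanishes_off.abs_eq)
  have [measurable]: "f \<in> borel_measurable lebesgue" "g \<in> borel_measurable lebesgue"
      "\<Omega> \<in> sets lebesgue"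
    using assms by (auto simp: square_integrable_def)
  have "AE x in lebesgue. f x \<bullet> g x = indicator \<Omega> x *\<^sub>R (f x \<bullet> g x)"
    using v by (rule eventually_mono) (auto simp: indicator_def)
  then have "(LINT x|lebesgue. f x \<bullet> g x) = (LINT x|lebesgue. indicator \<Omega> x *\<^sub>R (f x \<bullet> g x))"
    by (intro integral_cong_AE) auto
  then show ?thesis
    using r by (simp add: inner_L2.abs_eq set_lebesgue_integral_def)
qed


section \<open>Unbounded operators\<close>

text \<open>
  An operator is a partial map, with \<open>dom\<close> as its domain. Hence \<open>\<circ>\<^sub>m\<close> is composition on
  the natural domain, and equality of operators includes equality of their domains.
\<close>

definition linear_op :: "('a::real_vector \<rightharpoonup> 'b::real_vector) \<Rightarrow> bool" where
  "linear_op A \<longleftrightarrow> subspace (dom A) \<and>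
     (\<forall>x\<in>dom A. \<forall>y\<in>dom A. the (A (x + y)) = the (A x) + the (A y)) \<and>
     (\<forall>c. \<forall>x\<in>dom A. the (A (c *\<^sub>R x)) = c *\<^sub>R the (A x))"

definition operator_between ::
  "'a::real_vector set \<Rightarrow> 'b::real_vector set \<Rightarrow> ('a \<rightharpoonup> 'b) \<Rightarrow> bool" where
  "operator_between V W A \<longleftrightarrow> linear_op A \<and> dom A \<subseteq> V \<and> ran A \<subseteq> W"

definition densely_defined :: "'a::topological_space set \<Rightarrow> ('a \<rightharpoonup> 'b) \<Rightarrow> bool" where
  "densely_defined V A \<longleftrightarrow> dom A \<subseteq> V \<and> V \<subseteq> closure (dom A)"

definition closed_op :: "('a::topological_space \<rightharpoonup> 'b::topological_space) \<Rightarrow> bool" where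
  "closed_op A \<longleftrightarrow> closed (Map.graph A)"

definition op_kernel :: "('a \<rightharpoonup> 'b::zero) \<Rightarrow> 'a set" where
  "op_kernel A = {x. A x = Some 0}"

text \<open>
  The adjoint of \<open>A\<close> as an operator from \<open>V\<close> to \<open>W\<close>. The vector \<open>\<xi>\<close> is unique, whenever it
  exists, exactly if no nonzero vector of \<open>V\<close> is orthogonal to the domain of \<open>A\<close>; in
  particular if \<open>A\<close> is densely defined in \<open>V\<close>.
\<close>

definition adjoint_op ::
  "'a::real_inner set \<Rightarrow> 'b::real_inner set \<Rightarrow> ('a \<rightharpoonup> 'b) \<Rightarrow> ('b \<rightharpoonup> 'a)" where
  "adjoint_op V W A = (\<lambda>\<psi>.
     let P = (\<lambda>\<xi>. \<xi> \<in> V \<and> (\<forall>\<phi>\<in>dom A. the (A \<phi>) \<bullet> \<psi> = \<phi> \<bullet> \<xi>))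
     in if \<psi> \<in> W \<and> (\<exists>!\<xi>. P \<xi>) then Some (THE \<xi>. P \<xi>) else None)"

text \<open>
  Boundedness from above is a bound on the quadratic form, which is weaker than boundedness
  in operator norm.
\<close>

definition bounded_above_op :: "('a::real_inner \<rightharpoonup> 'a) \<Rightarrow> bool" where
  "bounded_above_op A \<longleftrightarrow> (\<exists>C. \<forall>v\<in>dom A. the (A v) \<bullet> v \<le> C * (norm v)\<^sup>2)"

definition zero_op :: "'a set \<Rightarrow> ('a \<rightharpoonup> 'b::zero)" where
  "zero_op V = (\<lambda>x. if x \<in> V then Some 0 else None)"

definition id_op :: "'a set \<Rightarrow> ('a \<rightharpoonup> 'a)" where
  "id_op V = Some |` V"

definition neg_op :: "('a \<rightharpoonup> 'b::uminus) \<Rightarrow> ('a \<rightharpoonup> 'b)" where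
  "neg_op A = (\<lambda>x. map_option uminus (A x))"

definition block_op ::
  "('a \<rightharpoonup> 'c::plus) \<Rightarrow> ('b \<rightharpoonup> 'c) \<Rightarrow> ('a \<rightharpoonup> 'd::plus) \<Rightarrow> ('b \<rightharpoonup> 'd) \<Rightarrow>
   ('a \<times> 'b \<rightharpoonup> 'c \<times> 'd)" where
  "block_op A B C D = (\<lambda>(x, y).
     if x \<in> dom A \<inter> dom C \<and> y \<in> dom B \<inter> dom D
     then Some (the (A x) + the (B y), the (C x) + the (D y)) else None)"


section \<open>The wave-like system and its two representations\<close>

text \<open>
  The observation space, dual to the control space \<open>'u\<close>, is the type of bounded linear
  functionals on \<open>'u\<close>, so that the duality pairing is \<open>blinfun_apply\<close>.
\<close>

definition formal_adjoint_pair ::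
  "'x::real_inner set \<Rightarrow> 'y::real_inner set \<Rightarrow> ('x \<rightharpoonup> 'y) \<Rightarrow> ('y \<rightharpoonup> 'x) \<Rightarrow>
   ('x \<rightharpoonup> ('u::real_normed_vector \<Rightarrow>\<^sub>L real)) \<Rightarrow> ('y \<rightharpoonup> 'u) \<Rightarrow> bool" where
  "formal_adjoint_pair V W K Kd \<gamma> \<beta> \<longleftrightarrow>
     operator_between V W K \<and> operator_between W V Kd \<and>
     linear_op \<gamma> \<and> dom \<gamma> = dom K \<and> linear_op \<beta> \<and> dom \<beta> = dom Kd \<and>
     (\<forall>\<phi>\<in>dom K. \<forall>\<psi>\<in>dom Kd.
        the (K \<phi>) \<bullet> \<psi> = \<phi> \<bullet> the (Kd \<psi>) + blinfun_apply (the (\<gamma> \<phi>)) (the (\<beta> \<psi>))) \<and>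
     adjoint_op V W (K |` op_kernel \<gamma>) = Kd \<and>
     adjoint_op W V (Kd |` op_kernel \<beta>) = K"

definition hamiltonian ::
  "('x::real_inner \<rightharpoonup> 'y::real_inner) \<Rightarrow> ('y \<rightharpoonup> 'y) \<Rightarrow> ('x \<rightharpoonup> 'x) \<Rightarrow> 'x \<times> 'x \<Rightarrow> real" where
  "hamiltonian K \<eta> \<kappa> = (\<lambda>(a\<^sub>1, a\<^sub>2).
     (the (K a\<^sub>1) \<bullet> the ((\<eta> \<circ>\<^sub>m K) a\<^sub>1) + a\<^sub>2 \<bullet> the (\<kappa> a\<^sub>2)) / 2)"

definition wave_like_system ::
  "('x::real_inner \<rightharpoonup> 'y::real_inner) \<Rightarrow> ('y \<rightharpoonup> 'x) \<Rightarrow> ('y \<rightharpoonup> 'y) \<Rightarrow> ('x \<rightharpoonup> 'x) \<Rightarrow>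
   real set \<Rightarrow> (real \<Rightarrow> 'x) \<Rightarrow> (real \<Rightarrow> 'x) \<Rightarrow> bool" where
  "wave_like_system K Kd \<eta> \<kappa> T \<alpha>\<^sub>1 \<alpha>\<^sub>2 \<longleftrightarrow> (\<forall>t\<in>T.
     \<alpha>\<^sub>1 t \<in> dom (Kd \<circ>\<^sub>m \<eta> \<circ>\<^sub>m K) \<and> \<alpha>\<^sub>2 t \<in> dom \<kappa> \<and>
     (\<alpha>\<^sub>1 has_vector_derivative the (\<kappa> (\<alpha>\<^sub>2 t))) (at t within T) \<and>
     (\<alpha>\<^sub>2 has_vector_derivative - the ((Kd \<circ>\<^sub>m \<eta> \<circ>\<^sub>m K) (\<alpha>\<^sub>1 t))) (at t within T))"

definition evolves ::
  "real set \<Rightarrow> ('z::real_normed_vector \<rightharpoonup> 'w::real_normed_vector) \<Rightarrow> (real \<Rightarrow> 'z) \<Rightarrow> (real \<Rightarrow> 'w) \<Rightarrow> bool"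
where
  "evolves T J e \<alpha> \<longleftrightarrow>
     (\<forall>t\<in>T. e t \<in> dom J \<and> (\<alpha> has_vector_derivative the (J (e t))) (at t within T))"

definition state_SD :: "('x \<rightharpoonup> 'y) \<Rightarrow> 'x \<times> 'x \<Rightarrow> 'y \<times> 'x" where
  "state_SD K = (\<lambda>(a\<^sub>1, a\<^sub>2). (the (K a\<^sub>1), a\<^sub>2))"

definition effort_SD :: "('y \<rightharpoonup> 'y) \<Rightarrow> ('x \<rightharpoonup> 'x) \<Rightarrow> 'y \<times> 'x \<Rightarrow> 'y \<times> 'x" where
  "effort_SD \<eta> \<kappa> = (\<lambda>(s\<^sub>1, s\<^sub>2). (the (\<eta> s\<^sub>1), the (\<kappa> s\<^sub>2)))"

definition J_SD ::
  "'x::real_vector set \<Rightarrow> 'y::real_vector set \<Rightarrow> ('x \<rightharpoonup> 'y) \<Rightarrow> ('y \<rightharpoonup> 'x) \<Rightarrow> ('y \<times> 'x \<rightharpoonup> 'y \<times> 'x)"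
where
  "J_SD V W K Kd = block_op (zero_op W) K (neg_op Kd) (zero_op V)"

definition state_SL :: "'x \<times> 'x \<Rightarrow> 'x \<times> 'x" where
  "state_SL = (\<lambda>(a\<^sub>1, a\<^sub>2). (a\<^sub>1, a\<^sub>2))"

definition effort_SL ::
  "('x \<rightharpoonup> 'y) \<Rightarrow> ('y \<rightharpoonup> 'x) \<Rightarrow> ('y \<rightharpoonup> 'y) \<Rightarrow> ('x \<rightharpoonup> 'x) \<Rightarrow> 'x \<times> 'x \<Rightarrow> 'x \<times> 'x" where
  "effort_SL K Kd \<eta> \<kappa> = (\<lambda>(s\<^sub>1, s\<^sub>2). (the ((Kd \<circ>\<^sub>m \<eta> \<circ>\<^sub>m K) s\<^sub>1), the (\<kappa> s\<^sub>2)))"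

definition J_SL :: "'x::real_vector set \<Rightarrow> ('x \<times> 'x \<rightharpoonup> 'x \<times> 'x)" where
  "J_SL V = block_op (zero_op V) (id_op V) (neg_op (id_op V)) (zero_op V)"

definition G_op ::
  "'x::real_vector set \<Rightarrow> ('x \<rightharpoonup> 'y::real_vector) \<Rightarrow> ('x \<times> 'x \<rightharpoonup> 'y \<times> 'x)" where
  "G_op V K = block_op K (zero_op V) (zero_op V) (id_op V)"

definition G_dagger_op ::
  "'x::real_vector set \<Rightarrow> 'y::real_vector set \<Rightarrow> ('y \<rightharpoonup> 'x) \<Rightarrow> ('y \<times> 'x \<rightharpoonup> 'x \<times> 'x)" where
  "G_dagger_op V W Kd = block_op Kd (zero_op V) (zero_op W) (id_op V)"

end

theory Submission
  imports Defs
begin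

text \<open>
  The three algebraic identities hold because \<open>K\<close> appears once in \<open>G\<close> and \<open>K\<^sup>\<dagger>\<close> once in \<open>G\<^sup>\<dagger>\<close>, so
  that the symplectic matrix between them becomes the Stokes-Dirac structure operator. What has
  to be checked is the domains. Those of \<open>K\<close> and \<open>\<kappa>\<close> and the ranges of \<open>K\<^sup>\<dagger>\<close> and \<open>\<kappa>\<close> lie in
  \<open>L\<^sup>2(\<Omega>)\<close>, hence every vector that meets an identity or zero block is in the domain of that
  block. The natural domain of the composition is therefore exactly \<open>dom K\<^sup>\<dagger> \<times> dom K\<close>
  (lemma \<open>G_J_SL_G_dagger\<close>).

  The Stokes-Lagrange evolution is the wave-like system itself, read componentwise. The
  Stokes-Dirac evolution needs analysis: when \<open>\<alpha>\<^sup>S\<^sup>D\<close> is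
  differentiable, its first row says that the time derivative commutes
  with the unbounded operator \<open>K\<close>, that is, \<open>\<partial>\<^sub>t (K \<alpha>\<^sub>1) = K (\<partial>\<^sub>t \<alpha>\<^sub>1) = K (\<kappa> \<alpha>\<^sub>2)\<close>, and in
  particular that \<open>\<kappa> \<alpha>\<^sub>2\<close> lies in the domain of \<open>K\<close>, which the wave-like system does not
  assert. Both follow from closedness: the curve \<open>(\<alpha>\<^sub>1, K \<alpha>\<^sub>1)\<close> stays in the graph of \<open>K\<close>, a closed
  subspace, hence so do its difference quotients and their limit
  (lemmas \<open>has_vector_derivative_in_closed_subspace\<close> and \<open>closed_op_has_vector_derivative\<close>).
\<close>

lemma has_vector_derivative_imp_slope_tendsto:
  fixes u :: "real \<Rightarrow> 'a::real_normed_vector"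
  assumes "(u has_vector_derivative d) (at t within T)"
  shows "((\<lambda>s. inverse (s - t) *\<^sub>R (u s - u t)) \<longlongrightarrow> d) (at t within T)"
proof (rule LIM_zero_cancel, rule tendsto_norm_zero_cancel)
  have "((\<lambda>s. (1 / norm (s - t)) *\<^sub>R (u s - (u t + (s - t) *\<^sub>R d))) \<longlongrightarrow> 0) (at t within T)"
    using assms unfolding has_vector_derivative_def has_derivative_within by (rule conjunct2)
  then have "((\<lambda>s. norm ((1 / norm (s - t)) *\<^sub>R (u s - (u t + (s - t) *\<^sub>R d)))) \<longlongrightarrow> 0) (at t within T)"
    by (rule tendsto_norm_zero)
  moreover have "norm ((1 / norm (s - t)) *\<^sub>R (u s - (u t + (s - t) *\<^sub>R d)))
      = norm (inverse (s - t) *\<^sub>R (u s - u t) - d)" if "s \<noteq> t" for s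
  proof -
    have "inverse (s - t) *\<^sub>R (u s - u t) - d
        = inverse (s - t) *\<^sub>R (u s - (u t + (s - t) *\<^sub>R d))"
      using that by (simp add: scaleR_diff_right scaleR_add_right)
    then show ?thesis by (simp add: inverse_eq_divide)
  qed
  ultimately show "((\<lambda>s. norm (inverse (s - t) *\<^sub>R (u s - u t) - d)) \<longlongrightarrow> 0) (at t within T)"
    by (subst Lim_cong_within[OF refl refl refl]) auto
qed

lemma has_vector_derivative_in_closed_subspace:
  fixes u :: "real \<Rightarrow> 'a::real_normed_vector"
  assumes "closed S" "subspace S" "\<And>s. s \<in> T \<Longrightarrow> u s \<in> S" "t \<in> T" "t islimpt T"
    and "(u has_vector_derivative d) (at t within T)"
  shows "d \<in> S"
proof (rule Lim_in_closed_set)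
  show "\<forall>\<^sub>F s in at t within T. inverse (s - t) *\<^sub>R (u s - u t) \<in> S"
    unfolding eventually_at_filter
    using assms(2-4) by (intro always_eventually) (simp add: subspace_diff subspace_scale)
  show "at t within T \<noteq> bot"
    using assms(5) by (simp add: trivial_limit_within)
qed (rule assms has_vector_derivative_imp_slope_tendsto)+

lemma subspace_graph:
  assumes "linear_op A"
  shows "subspace (Map.graph A)"
proof (rule subspaceI)
  have dom: "subspace (dom A)"
    and add: "\<And>x y. \<lbrakk>x \<in> dom A; y \<in> dom A\<rbrakk> \<Longrightarrow> the (A (x + y)) = the (A x) + the (A y)"
    and scale: "\<And>c x. x \<in> dom A \<Longrightarrow> the (A (c *\<^sub>R x)) = c *\<^sub>R the (A x)"
    using assms by (auto simp: linear_op_def)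
  have graph: "p \<in> Map.graph A \<longleftrightarrow> fst p \<in> dom A \<and> the (A (fst p)) = snd p" for p
    by (cases p) (auto simp: Map.graph_def)
  show "0 \<in> Map.graph A"
    using subspace_0[OF dom] scale[of 0 0] by (simp add: graph)
  show "p + q \<in> Map.graph A" if "p \<in> Map.graph A" "q \<in> Map.graph A" for p q
    using that subspace_add[OF dom] add by (simp add: graph)
  show "c *\<^sub>R p \<in> Map.graph A" if "p \<in> Map.graph A" for c p
    using that subspace_scale[OF dom] scale by (simp add: graph)
qed

text \<open>
  That the derivative of the curve itself lies in the domain is part of the conclusion: the
  difference quotients lie in the domain, but the domain need not be closed. It is the
  convergence of their images that, by closedness of the graph, keeps the limit inside.
\<close>

lemma closed_op_has_vector_derivative:
  fixes A :: "'a::real_normed_vector \<rightharpoonup> 'b::real_normed_vector"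
  assumes "linear_op A" "closed_op A" "\<And>s. s \<in> T \<Longrightarrow> u s \<in> dom A" "t \<in> T" "t islimpt T"
    and "(u has_vector_derivative u') (at t within T)"
    and "((\<lambda>s. the (A (u s))) has_vector_derivative v') (at t within T)"
  shows "A u' = Some v'"
proof -
  have "(u', v') \<in> Map.graph A"
  proof (rule has_vector_derivative_in_closed_subspace)
    show "closed (Map.graph A)"
      using assms(2) by (simp add: closed_op_def)
    show "(u s, the (A (u s))) \<in> Map.graph A" if "s \<in> T" for s
      using assms(3)[OF that] by (auto simp: Map.graph_def)
    show "((\<lambda>s. (u s, the (A (u s)))) has_vector_derivative (u', v')) (at t within T)"
      using assms(6,7) by (rule has_vector_derivative_Pair)
  qed (rule subspace_graph assms)+
  then show ?thesis by (rule in_graphD)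
qed

text \<open>
  Every point of the time interval, the endpoints included, has to be a limit of other times;
  otherwise a derivative within \<open>T\<close> is not a limit of difference quotients.
\<close>

lemma islimpt_interval_real:
  fixes T :: "real set"
  assumes "is_interval T" "interior T \<noteq> {}" "t \<in> T"
  shows "t islimpt T"
proof (rule connected_imp_perfect)
  show "connected T"
    using assms(1) by (simp add: is_interval_connected_1)
  show "T \<noteq> {a}" for a
    using assms(2) by auto
qed (rule assms)

lemma block_op_Some_iff:
  "block_op A B C D (x, y) = Some p \<longleftrightarrow>
     x \<in> dom A \<and> x \<in> dom C \<and> y \<in> dom B \<and> y \<in> dom D \<and>
     p = (the (A x) + the (B y), the (C x) + the (D y))"
  by (auto simp: block_op_def)

lemma dom_zero_op [simp]: "dom (zero_op V) = V"
  by (auto simp: zero_op_def split: if_splits)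

lemma dom_id_op [simp]: "dom (id_op V) = V"
  by (simp add: id_op_def)

lemma dom_neg_op [simp]: "dom (neg_op A) = dom A"
  by (auto simp: neg_op_def)

lemma the_zero_op [simp]: "x \<in> V \<Longrightarrow> the (zero_op V x) = 0"
  by (simp add: zero_op_def)

lemma the_id_op [simp]: "x \<in> V \<Longrightarrow> the (id_op V x) = x"
  by (simp add: id_op_def)

lemma the_neg_op [simp]: "x \<in> dom A \<Longrightarrow> the (neg_op A x) = - the (A x)"
  by (auto simp: neg_op_def)

lemma operator_between_the: "operator_between V W A \<Longrightarrow> x \<in> dom A \<Longrightarrow> the (A x) \<in> W"
  by (auto simp: operator_between_def ran_def)

lemma operator_between_dom: "operator_between V W A \<Longrightarrow> x \<in> dom A \<Longrightarrow> x \<in> V"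
  by (auto simp: operator_between_def)

lemma G_op_Some_iff:
  assumes "operator_between V W K"
  shows "G_op V K (x, y) = Some p \<longleftrightarrow> x \<in> dom K \<and> y \<in> V \<and> p = (the (K x), y)"
  using operator_between_dom[OF assms, of x]
  by (cases "x \<in> dom K"; simp add: G_op_def block_op_Some_iff cong: conj_cong)

lemma G_dagger_op_Some_iff:
  assumes "operator_between W V Kd"
  shows "G_dagger_op V W Kd (y, x) = Some p \<longleftrightarrow> y \<in> dom Kd \<and> x \<in> V \<and> p = (the (Kd y), x)"
  using operator_between_dom[OF assms, of y]
  by (cases "y \<in> dom Kd"; simp add: G_dagger_op_def block_op_Some_iff cong: conj_cong)

lemma J_SL_Some_iff: "J_SL V (x, y) = Some p \<longleftrightarrow> x \<in> V \<and> y \<in> V \<and> p = (y, - x)"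
  by (auto simp: J_SL_def block_op_Some_iff)

lemma J_SD_Some_iff:
  assumes "operator_between V W K" "operator_between W V Kd"
  shows "J_SD V W K Kd (y, x) = Some p \<longleftrightarrow>
    y \<in> dom Kd \<and> x \<in> dom K \<and> p = (the (K x), - the (Kd y))"
  using operator_between_dom[OF assms(1), of x] operator_between_dom[OF assms(2), of y]
  by (cases "x \<in> dom K"; cases "y \<in> dom Kd"; simp add: J_SD_def block_op_Some_iff)

text \<open>
  The intermediate vector \<open>(K\<^sup>\<dagger> y, x)\<close> lies in \<open>V \<times> V\<close> because \<open>K\<^sup>\<dagger>\<close> maps into \<open>V\<close>, so the
  symplectic matrix restricts nothing. It swaps the components, which moves the domain
  condition of \<open>K\<close> onto \<open>x\<close>; the second component of its value stays in \<open>V\<close> because \<open>V\<close> is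
  closed under negation.
\<close>

lemma G_J_SL_G_dagger:
  assumes "subspace V" and K: "operator_between V W K" and Kd: "operator_between W V Kd"
  shows "G_op V K \<circ>\<^sub>m J_SL V \<circ>\<^sub>m G_dagger_op V W Kd = J_SD V W K Kd"
proof -
  have "(G_op V K \<circ>\<^sub>m J_SL V \<circ>\<^sub>m G_dagger_op V W Kd) (y, x) = Some p \<longleftrightarrow>
      J_SD V W K Kd (y, x) = Some p" for y x p
    using operator_between_dom[OF K, of x] operator_between_the[OF Kd, of y]
      subspace_neg[OF assms(1), of "the (Kd y)"]
    by (cases p)
      (auto simp: map_comp_Some_iff G_op_Some_iff[OF K] G_dagger_op_Some_iff[OF Kd]
        J_SL_Some_iff J_SD_Some_iff[OF K Kd])
  then show ?thesis
    by (intro ext) (metis option.exhaust surj_pair)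
qed

theorem theorem1:
  fixes \<Omega> :: "(real ^ 'N) set"
    and K :: "(real ^ 'N, real ^ 'n) L2 \<rightharpoonup> (real ^ 'N, real ^ 'm) L2"
    and Kd :: "(real ^ 'N, real ^ 'm) L2 \<rightharpoonup> (real ^ 'N, real ^ 'n) L2"
    and \<gamma> :: "(real ^ 'N, real ^ 'n) L2 \<rightharpoonup> ('u::real_normed_vector \<Rightarrow>\<^sub>L real)"
    and \<beta> :: "(real ^ 'N, real ^ 'm) L2 \<rightharpoonup> 'u"
    and \<eta> :: "(real ^ 'N, real ^ 'm) L2 \<rightharpoonup> (real ^ 'N, real ^ 'm) L2"
    and \<kappa> :: "(real ^ 'N, real ^ 'n) L2 \<rightharpoonup> (real ^ 'N, real ^ 'n) L2"
    and T :: "real set"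
    and \<alpha>\<^sub>1 \<alpha>\<^sub>2 :: "real \<Rightarrow> (real ^ 'N, real ^ 'n) L2"
  defines "\<alpha>SD \<equiv> \<lambda>t. state_SD K (\<alpha>\<^sub>1 t, \<alpha>\<^sub>2 t)"
    and "\<alpha>SL \<equiv> \<lambda>t. state_SL (\<alpha>\<^sub>1 t, \<alpha>\<^sub>2 t)"
  defines "eSD \<equiv> \<lambda>t. effort_SD \<eta> \<kappa> (\<alpha>SD t)"
    and "eSL \<equiv> \<lambda>t. effort_SL K Kd \<eta> \<kappa> (\<alpha>SL t)"
    and "JSD \<equiv> J_SD (L2_on \<Omega>) (L2_on \<Omega>) K Kd"
    and "JSL \<equiv> J_SL (L2_on \<Omega>)"
    and "G \<equiv> G_op (L2_on \<Omega>) K"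
    and "Gd \<equiv> G_dagger_op (L2_on \<Omega>) (L2_on \<Omega>) Kd"
  assumes "\<Omega> \<in> sets lebesgue"
    and "closed_op K" and "densely_defined (L2_on \<Omega>) K"
    and "formal_adjoint_pair (L2_on \<Omega>) (L2_on \<Omega>) K Kd \<gamma> \<beta>"
    and "operator_between (L2_on \<Omega>) (L2_on \<Omega>) \<eta>" and "bounded_above_op \<eta>"
    and "operator_between (L2_on \<Omega>) (L2_on \<Omega>) \<kappa>" and "bounded_above_op \<kappa>"
    and "\<And>a\<^sub>1 a\<^sub>2. a\<^sub>1 \<in> dom (\<eta> \<circ>\<^sub>m K) \<Longrightarrow> a\<^sub>2 \<in> dom \<kappa> \<Longrightarrow> 0 \<le> hamiltonian K \<eta> \<kappa> (a\<^sub>1, a\<^sub>2)"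
    and "is_interval T" and "interior T \<noteq> {}"
    and "wave_like_system K Kd \<eta> \<kappa> T \<alpha>\<^sub>1 \<alpha>\<^sub>2"
  shows "(\<forall>t\<in>T. G (\<alpha>SL t) = Some (\<alpha>SD t)) \<and>
         (\<forall>t\<in>T. Gd (eSD t) = Some (eSL t)) \<and>
         G \<circ>\<^sub>m JSL \<circ>\<^sub>m Gd = JSD \<and>
         evolves T JSL eSL \<alpha>SL \<and>
         ((\<forall>t\<in>T. \<alpha>SD differentiable (at t within T)) \<longrightarrow> evolves T JSD eSD \<alpha>SD)"
proof -
  let ?V = "L2_on \<Omega> :: (real ^ 'N, real ^ 'n) L2 set"
  let ?W = "L2_on \<Omega> :: (real ^ 'N, real ^ 'm) L2 set"
  have K: "operator_between ?V ?W K" and Kd: "operator_between ?W ?V Kd"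
    using assms(12) by (simp_all add: formal_adjoint_pair_def)
  have \<kappa>: "operator_between ?V ?V \<kappa>" by fact

  have dom: "\<alpha>\<^sub>1 t \<in> dom K" "the (\<eta> (the (K (\<alpha>\<^sub>1 t)))) \<in> dom Kd" "\<alpha>\<^sub>2 t \<in> dom \<kappa>"
    and comp: "the ((Kd \<circ>\<^sub>m \<eta> \<circ>\<^sub>m K) (\<alpha>\<^sub>1 t)) = the (Kd (the (\<eta> (the (K (\<alpha>\<^sub>1 t))))))"
    and deriv: "(\<alpha>\<^sub>1 has_vector_derivative the (\<kappa> (\<alpha>\<^sub>2 t))) (at t within T)"
      "(\<alpha>\<^sub>2 has_vector_derivative - the ((Kd \<circ>\<^sub>m \<eta> \<circ>\<^sub>m K) (\<alpha>\<^sub>1 t))) (at t within T)"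
    if "t \<in> T" for t
  proof -
    have 1: "\<alpha>\<^sub>1 t \<in> dom (Kd \<circ>\<^sub>m \<eta> \<circ>\<^sub>m K)" and 2: "\<alpha>\<^sub>2 t \<in> dom \<kappa>"
      and 3: "(\<alpha>\<^sub>1 has_vector_derivative the (\<kappa> (\<alpha>\<^sub>2 t))) (at t within T)"
      "(\<alpha>\<^sub>2 has_vector_derivative - the ((Kd \<circ>\<^sub>m \<eta> \<circ>\<^sub>m K) (\<alpha>\<^sub>1 t))) (at t within T)"
      using assms(20) that by (auto simp only: wave_like_system_def)
    show "\<alpha>\<^sub>1 t \<in> dom K" "the (\<eta> (the (K (\<alpha>\<^sub>1 t)))) \<in> dom Kd"
      "the ((Kd \<circ>\<^sub>m \<eta> \<circ>\<^sub>m K) (\<alpha>\<^sub>1 t)) = the (Kd (the (\<eta> (the (K (\<alpha>\<^sub>1 t))))))"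
      using 1 by (auto simp: dom_def map_comp_Some_iff)
    show "\<alpha>\<^sub>2 t \<in> dom \<kappa>"
      "(\<alpha>\<^sub>1 has_vector_derivative the (\<kappa> (\<alpha>\<^sub>2 t))) (at t within T)"
      "(\<alpha>\<^sub>2 has_vector_derivative - the ((Kd \<circ>\<^sub>m \<eta> \<circ>\<^sub>m K) (\<alpha>\<^sub>1 t))) (at t within T)"
      by (fact 2 3)+
  qed
  have SD: "\<alpha>SD t = (the (K (\<alpha>\<^sub>1 t)), \<alpha>\<^sub>2 t)"
    "eSD t = (the (\<eta> (the (K (\<alpha>\<^sub>1 t)))), the (\<kappa> (\<alpha>\<^sub>2 t)))" for t
    by (simp_all add: \<alpha>SD_def eSD_def state_SD_def effort_SD_def)
  have SL: "\<alpha>SL t = (\<alpha>\<^sub>1 t, \<alpha>\<^sub>2 t)"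
    "eSL t = (the ((Kd \<circ>\<^sub>m \<eta> \<circ>\<^sub>m K) (\<alpha>\<^sub>1 t)), the (\<kappa> (\<alpha>\<^sub>2 t)))" for t
    by (simp_all add: \<alpha>SL_def eSL_def state_SL_def effort_SL_def)

  have "G (\<alpha>SL t) = Some (\<alpha>SD t)" if "t \<in> T" for t
    using dom[OF that] operator_between_dom[OF \<kappa>]
    by (simp add: G_def SD SL G_op_Some_iff[OF K])

  moreover have "Gd (eSD t) = Some (eSL t)" if "t \<in> T" for t
    using dom[OF that] operator_between_the[OF \<kappa>]
    by (simp add: Gd_def SD SL G_dagger_op_Some_iff[OF Kd] comp[OF that])

  moreover have "G \<circ>\<^sub>m JSL \<circ>\<^sub>m Gd = JSD"
    unfolding G_def JSL_def Gd_def JSD_def by (rule G_J_SL_G_dagger[OF subspace_L2_on K Kd])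

  moreover have "evolves T JSL eSL \<alpha>SL"
    unfolding evolves_def
  proof
    fix t assume t: "t \<in> T"
    have "JSL (eSL t) = Some (the (\<kappa> (\<alpha>\<^sub>2 t)), - the ((Kd \<circ>\<^sub>m \<eta> \<circ>\<^sub>m K) (\<alpha>\<^sub>1 t)))"
      using dom[OF t] operator_between_the[OF \<kappa>] operator_between_the[OF Kd]
      by (simp add: JSL_def SL J_SL_Some_iff comp[OF t])
    moreover have "(\<alpha>SL has_vector_derivative
        (the (\<kappa> (\<alpha>\<^sub>2 t)), - the ((Kd \<circ>\<^sub>m \<eta> \<circ>\<^sub>m K) (\<alpha>\<^sub>1 t)))) (at t within T)"
      unfolding SL[abs_def] by (rule has_vector_derivative_Pair[OF deriv[OF t]])
    ultimately show "eSL t \<in> dom JSL \<and>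
        (\<alpha>SL has_vector_derivative the (JSL (eSL t))) (at t within T)"
      by auto
  qed

  moreover have "evolves T JSD eSD \<alpha>SD" if diff: "\<forall>t\<in>T. \<alpha>SD differentiable (at t within T)"
    unfolding evolves_def
  proof
    fix t assume t: "t \<in> T"
    let ?v = "vector_derivative \<alpha>SD (at t within T)"
    have "(\<alpha>SD has_vector_derivative ?v) (at t within T)"
      using diff t vector_derivative_works by blast
    then have K\<alpha>: "((\<lambda>s. the (K (\<alpha>\<^sub>1 s))) has_vector_derivative fst ?v) (at t within T)"
      using bounded_linear.has_vector_derivative[OF bounded_linear_fst] by (fastforce simp: SD)
    have "K (the (\<kappa> (\<alpha>\<^sub>2 t))) = Some (fst ?v)"
    proof (rule closed_op_has_vector_derivative[OF _ _ _ t _ deriv(1)[OF t] K\<alpha>])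
      show "linear_op K" using K by (simp add: operator_between_def)
      show "t islimpt T" using assms(18,19) t by (rule islimpt_interval_real)
    qed (use assms dom in auto)
    then have "JSD (eSD t) = Some (fst ?v, - the ((Kd \<circ>\<^sub>m \<eta> \<circ>\<^sub>m K) (\<alpha>\<^sub>1 t)))"
      using dom[OF t] by (auto simp: JSD_def SD J_SD_Some_iff[OF K Kd] comp[OF t])
    moreover have "(\<alpha>SD has_vector_derivative
        (fst ?v, - the ((Kd \<circ>\<^sub>m \<eta> \<circ>\<^sub>m K) (\<alpha>\<^sub>1 t)))) (at t within T)"
      unfolding SD(1)[abs_def]
      by (rule has_vector_derivative_Pair[OF K\<alpha>[unfolded SD(1)[abs_def]] deriv(2)[OF t]])
    ultimately show "eSD t \<in> dom JSD \<and>
        (\<alpha>SD has_vector_derivative the (JSD (eSD t))) (at t within T)"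
      by auto
  qed

  ultimately show ?thesis by blast
qed

end
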